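(* Consider a map $d:\Phi\to\mathbb{K}\setminus\{0\}$, $\phi\mapsto\phi'$. Then $d$ extends to a series derivation on $\mathbb{K}$ if the following two properties hold: (1) the set $E_1:=\{\phi\in\Phi\ :\ \exists\,\psi\in\Phi,\ \psi\succ\phi,\ I_{\psi,\phi}\text{ is not a left shift}\}$ is well-ordered in $\Phi$; (2) the set $$E_2:=\left\{\psi\in\Phi\ :\ \exists\,\phi\in\Phi,\ \phi\prec\psi,\ \exists\,\tau^{(\phi)}\in\mathrm{Supp}\,\tfrac{\phi'}{\phi},\ \exists\,\tau^{(\psi)}\in\mathrm{Supp}\,\tfrac{\psi'}{\psi}\ \text{ such that }\ \mathrm{LF}\left(\tfrac{\tau^{(\phi)}}{\tau^{(\psi)}}\right)\succcurlyeq\psi\right\}$$ is anti-well-ordered in $\Phi$.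
   Context: Let $(\Phi,\preccurlyeq)$ be a totally ordered set (the fundamental monomials). A set is anti-well-ordered if each nonempty subset has a greatest element. The Hahn group $\mathbf{H}(\Phi)$ is the set of formal products $\gamma=\prod_{\phi\in\Phi}\phi^{\gamma_\phi}$ with $\gamma_\phi\in\mathbb{R}$ and $\mathrm{supp}\,\gamma:=\{\phi\in\Phi:\gamma_\phi\neq 0\}$ anti-well-ordered in $\Phi$; multiplication adds exponents pointwise, and $\gamma\succ 1$ iff $\gamma_\phi>0$ for $\phi=\max(\mathrm{supp}\,\gamma)$. This is a totally ordered abelian group, with $\Phi\subset\mathbf{H}(\Phi)$ as ordered set and $\phi\succ1$ for all $\phi\in\Phi$. Fix a subgroup $\Gamma$ of $\mathbf{H}(\Phi)$ with $\Phi\subset\Gamma$. For $\gamma\in\Gamma\setminus\{1\}$ put $\mathrm{LF}(\gamma):=\max(\mathrm{supp}\,\gamma)\in\Phi$, and $\mathrm{LF}(1):=1$. $\mathbb{K}:=\mathbb{R}((\Gamma))$ is the field of generalised series $a=\sum_{\alpha}a_\alpha\alpha$, i.e. maps $a:\Gamma\to\mathbb{R}$ whose support $\mathrm{Supp}\,a=\{\alpha\in\Gamma: a_\alpha\ne0\}$ is anti-well-ordered in $\Gamma$, with componentwise sum and convolution product. A family $(a_i)_{i\in I}$ in $\mathbb{K}$ is summable if $\bigcup_i\mathrm{Supp}\,a_i$ is anti-well-ordered in $\Gamma$ and for each $\alpha$ the set $\{i\in I:\alpha\in\mathrm{Supp}\,a_i\}$ is finite; its sum is then defined coefficientwise (finite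 families are always summable). A map $d:\Phi\to\mathbb{K}\setminus\{0\}$, $\phi\mapsto\phi'$, extends to a series derivation on $\Gamma$ if (SD1): for every $\alpha\in\Gamma$ the family $\left(\frac{\phi'}{\phi}\right)_{\phi\in\mathrm{supp}\,\alpha}$ is summable. The series derivation on $\Gamma$ is then the map $\Gamma\to\mathbb{K}$ given by $1'=0$ and $\alpha'=\alpha\sum_{\phi\in\mathrm{supp}\,\alpha}\alpha_\phi\frac{\phi'}{\phi}$. A series derivation on $\Gamma$ extends to a series derivation on $\mathbb{K}$ if (SD2): for every $a\in\mathbb{K}$ the family $(\alpha')_{\alpha\in\mathrm{Supp}\,a}$ is summable; the extension is $a'=\sum_{\alpha\in\mathrm{Supp}\,a}a_\alpha\alpha'$. The map $d$ on $\Phi$ extends to a series derivation on $\mathbb{K}$ if (SD1) holds and the resulting series derivation on $\Gamma$ satisfies (SD2). The isomorphisms $I_{\mu,\nu}$: the order type $ot(E)$ of an anti-well-ordered set $E$ is identified with the ordinal enumerating $E$ in decreasing order. If $\mu,\nu\in\Phi$ and $ot(\mathrm{Supp}\,\frac{\mu'}{\mu})\le ot(\mathrm{Supp}\,\frac{\nu'}{\nu})$, then $I_{\mu,\nu}$ denotes the isomorphism of ordered sets from $\mathrm{Supp}\,\frac{\mu'}{\mu}$ onto a final (upper) segment of $\mathrm{Supp}\,\frac{\nu'}{\nu}$, and $I_{\nu,\mu}$ denotes its inverse (defined on that final segment). Thus, for all $\mu,\nu$, $I_{\mu,\nu}$ sends the element at position $\lambda$ (an ordinal) in the decreasing enumeration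 of $\mathrm{Supp}\,\frac{\mu'}{\mu}$ to the element at position $\lambda$ of $\mathrm{Supp}\,\frac{\nu'}{\nu}$, whenever both exist. $I_{\mu,\nu}$ is a left shift if $I_{\mu,\nu}(\gamma)\prec\gamma$ for every $\gamma$ in the domain of $I_{\mu,\nu}$. *)

theory Defs
  imports Complex_Main
begin

definition anti_well_ordered :: "'b::linorder set \<Rightarrow> bool" where
  "anti_well_ordered A \<longleftrightarrow> (\<forall>B\<subseteq>A. B \<noteq> {} \<longrightarrow> (\<exists>m\<in>B. \<forall>x\<in>B. x \<le> m))"

definition well_ordered :: "'b::linorder set \<Rightarrow> bool" where
  "well_ordered A \<longleftrightarrow> (\<forall>B\<subseteq>A. B \<noteq> {} \<longrightarrow> (\<exists>m\<in>B. \<forall>x\<in>B. m \<le> x))"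

lemma anti_well_ordered_empty [simp]: "anti_well_ordered {}"
  by (simp add: anti_well_ordered_def)

lemma anti_well_ordered_subset: "anti_well_ordered B \<Longrightarrow> A \<subseteq> B \<Longrightarrow> anti_well_ordered A"
  unfolding anti_well_ordered_def by (meson order_trans)

lemma anti_well_ordered_Un:
  assumes "anti_well_ordered A" and "anti_well_ordered B"
  shows "anti_well_ordered (A \<union> B)"
  unfolding anti_well_ordered_def
proof (intro allI impI)
  fix C assume C: "C \<subseteq> A \<union> B" "C \<noteq> {}"
  show "\<exists>m\<in>C. \<forall>x\<in>C. x \<le> m"
  proof (cases "C \<inter> A = {} \<or> C \<inter> B = {}")
    case True
    then have "C \<subseteq> A \<or> C \<subseteq> B" using C by blast
    then show ?thesis using assms C(2) unfolding anti_well_ordered_def by blast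
  next
    case False
    obtain a where a: "a \<in> C" "\<forall>x\<in>C \<inter> A. x \<le> a"
      using assms(1) False unfolding anti_well_ordered_def by (metis Int_iff inf_le2)
    obtain b where b: "b \<in> C" "\<forall>x\<in>C \<inter> B. x \<le> b"
      using assms(2) False unfolding anti_well_ordered_def by (metis Int_iff inf_le2)
    have "\<forall>x\<in>C. x \<le> max a b"
      using a b C by (metis Int_iff UnE le_max_iff_disj subsetD)
    moreover have "max a b \<in> C" using a b by (simp add: max_def)
    ultimately show ?thesis by blast
  qed
qed

lemma anti_well_ordered_singleton [simp]: "anti_well_ordered {x}"
  by (auto simp: anti_well_ordered_def subset_singleton_iff)


section \<open>The Hahn group\<close>

text \<open>
  The totally ordered set of fundamental monomials is the linearly ordered type \<open>'a\<close>. The Hahn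
  group over it is written additively, so that it is an instance of
  \<^class>\<open>linordered_ab_group_add\<close>: the product of two monomials is \<open>+\<close>, the quotient is \<open>-\<close> and
  the monomial 1 is \<open>0\<close>. An element is given by its exponents.
\<close>

typedef (overloaded) 'a hahn = "{\<gamma> :: 'a::linorder \<Rightarrow> real. anti_well_ordered {\<phi>. \<gamma> \<phi> \<noteq> 0}}"
  morphisms expo Abs_hahn
  by (rule exI[of _ "\<lambda>_. 0"]) simp

definition supp :: "'a::linorder hahn \<Rightarrow> 'a set" where
  "supp \<gamma> = {\<phi>. expo \<gamma> \<phi> \<noteq> 0}"

lemma anti_well_ordered_supp: "anti_well_ordered (supp \<gamma>)"
  using expo[of \<gamma>] by (simp add: supp_def)

lemma hahn_eqI: "(\<And>\<phi>. expo \<gamma> \<phi> = expo \<delta> \<phi>) \<Longrightarrow> \<gamma> = \<delta>"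
  by (metis expo_inject ext)

text \<open>Only meaningful for \<open>\<gamma> \<noteq> 0\<close>.\<close>

definition max_supp :: "'a::linorder hahn \<Rightarrow> 'a" where
  "max_supp \<gamma> = (GREATEST \<phi>. \<phi> \<in> supp \<gamma>)"

lemma max_supp_eqI: "\<phi> \<in> supp \<gamma> \<Longrightarrow> (\<And>\<psi>. \<psi> \<in> supp \<gamma> \<Longrightarrow> \<psi> \<le> \<phi>) \<Longrightarrow> max_supp \<gamma> = \<phi>"
  unfolding max_supp_def by (rule Greatest_equality)

instantiation hahn :: (linorder) ab_group_add
begin

definition zero_hahn :: "'a hahn" where
  "0 = Abs_hahn (\<lambda>_. 0)"

definition plus_hahn :: "'a hahn \<Rightarrow> 'a hahn \<Rightarrow> 'a hahn" where
  "\<gamma> + \<delta> = Abs_hahn (\<lambda>\<phi>. expo \<gamma> \<phi> + expo \<delta> \<phi>)"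

definition uminus_hahn :: "'a hahn \<Rightarrow> 'a hahn" where
  "- \<gamma> = Abs_hahn (\<lambda>\<phi>. - expo \<gamma> \<phi>)"

definition minus_hahn :: "'a hahn \<Rightarrow> 'a hahn \<Rightarrow> 'a hahn" where
  "\<gamma> - \<delta> = \<gamma> + - (\<delta> :: 'a hahn)"

lemma expo_zero [simp]: "expo 0 \<phi> = 0"
  by (simp add: zero_hahn_def Abs_hahn_inverse)

lemma expo_plus [simp]: "expo (\<gamma> + \<delta>) \<phi> = expo \<gamma> \<phi> + expo \<delta> \<phi>"
proof -
  have "anti_well_ordered {\<phi>. expo \<gamma> \<phi> + expo \<delta> \<phi> \<noteq> 0}"
    by (rule anti_well_ordered_subset[OF anti_well_ordered_Un[OF
          anti_well_ordered_supp[of \<gamma>] anti_well_ordered_supp[of \<delta>]]])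
       (auto simp: supp_def)
  then show ?thesis by (simp add: plus_hahn_def Abs_hahn_inverse)
qed

lemma expo_uminus [simp]: "expo (- \<gamma>) \<phi> = - expo \<gamma> \<phi>"
  using expo[of \<gamma>] by (simp add: uminus_hahn_def Abs_hahn_inverse)

lemma expo_minus [simp]: "expo (\<gamma> - \<delta>) \<phi> = expo \<gamma> \<phi> - expo \<delta> \<phi>"
  by (simp add: minus_hahn_def)

instance
  by standard (rule hahn_eqI; simp)+

end

lemma supp_zero [simp]: "supp 0 = {}"
  by (simp add: supp_def)

lemma supp_eq_empty_iff [simp]: "supp \<gamma> = {} \<longleftrightarrow> \<gamma> = 0"
  by (auto simp: supp_def intro: hahn_eqI)

lemma supp_uminus [simp]: "supp (- \<gamma>) = supp \<gamma>"
  by (simp add: supp_def)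

lemma max_supp_uminus [simp]: "max_supp (- \<gamma>) = max_supp \<gamma>"
  by (simp add: max_supp_def)

lemma max_supp:
  assumes "\<gamma> \<noteq> 0"
  shows "max_supp \<gamma> \<in> supp \<gamma>" and "\<psi> \<in> supp \<gamma> \<Longrightarrow> \<psi> \<le> max_supp \<gamma>"
proof -
  have "supp \<gamma> \<noteq> {}" using assms by simp
  then obtain m where m: "m \<in> supp \<gamma>" "\<forall>x\<in>supp \<gamma>. x \<le> m"
    using anti_well_ordered_supp[of \<gamma>] unfolding anti_well_ordered_def by (meson subset_refl)
  then have "max_supp \<gamma> = m" by (intro max_supp_eqI) auto
  with m show "max_supp \<gamma> \<in> supp \<gamma>" and "\<psi> \<in> supp \<gamma> \<Longrightarrow> \<psi> \<le> max_supp \<gamma>"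
    by auto
qed

text \<open>\<open>\<gamma> \<succ> 1\<close> in multiplicative notation.\<close>

definition hahn_pos :: "'a::linorder hahn \<Rightarrow> bool" where
  "hahn_pos \<gamma> \<longleftrightarrow> \<gamma> \<noteq> 0 \<and> expo \<gamma> (max_supp \<gamma>) > 0"

lemma hahn_pos_add:
  assumes "hahn_pos \<gamma>" and "hahn_pos \<delta>"
  shows "hahn_pos (\<gamma> + \<delta>)"
proof -
  define m where "m = max (max_supp \<gamma>) (max_supp \<delta>)"
  have \<gamma>: "\<gamma> \<noteq> 0" "expo \<gamma> (max_supp \<gamma>) > 0" and \<delta>: "\<delta> \<noteq> 0" "expo \<delta> (max_supp \<delta>) > 0"
    using assms by (auto simp: hahn_pos_def)
  have above: "expo \<gamma> \<psi> = 0" "expo \<delta> \<psi> = 0" if "m < \<psi>" for \<psi>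
    using that max_supp(2)[OF \<gamma>(1), of \<psi>] max_supp(2)[OF \<delta>(1), of \<psi>]
    by (force simp: m_def supp_def)+
  have ge: "expo \<gamma> m \<ge> 0" "expo \<delta> m \<ge> 0"
    using \<gamma>(2) \<delta>(2) max_supp(2)[OF \<gamma>(1), of m] max_supp(2)[OF \<delta>(1), of m]
    by (cases "max_supp \<gamma>" "max_supp \<delta>" rule: linorder_cases; force simp: m_def supp_def)+
  have "expo \<gamma> m > 0 \<or> expo \<delta> m > 0"
    using \<gamma>(2) \<delta>(2) by (auto simp: m_def max_def)
  then have pos: "expo (\<gamma> + \<delta>) m > 0" using ge by auto
  have "max_supp (\<gamma> + \<delta>) = m"
  proof (rule max_supp_eqI)
    show "m \<in> supp (\<gamma> + \<delta>)" using pos by (simp add: supp_def)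
    show "\<psi> \<le> m" if "\<psi> \<in> supp (\<gamma> + \<delta>)" for \<psi>
      using that above[of \<psi>] by (force simp: supp_def)
  qed
  then show ?thesis using pos unfolding hahn_pos_def by (metis expo_zero less_irrefl)
qed

lemma hahn_pos_uminus: "\<gamma> \<noteq> 0 \<Longrightarrow> hahn_pos (- \<gamma>) \<longleftrightarrow> \<not> hahn_pos \<gamma>"
  using max_supp(1)[of \<gamma>] by (auto simp: hahn_pos_def supp_def)

instantiation hahn :: (linorder) linordered_ab_group_add
begin

definition less_hahn :: "'a hahn \<Rightarrow> 'a hahn \<Rightarrow> bool" where
  "\<gamma> < \<delta> \<longleftrightarrow> hahn_pos (\<delta> - \<gamma>)"

definition less_eq_hahn :: "'a hahn \<Rightarrow> 'a hahn \<Rightarrow> bool" where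
  "\<gamma> \<le> \<delta> \<longleftrightarrow> \<gamma> = \<delta> \<or> \<gamma> < (\<delta> :: 'a hahn)"

instance
proof
  fix x y z :: "'a hahn"
  have irr: "\<not> a < a" for a :: "'a hahn"
    by (simp add: less_hahn_def hahn_pos_def)
  have tr: "a < c" if "a < b" "b < c" for a b c :: "'a hahn"
    using hahn_pos_add[of "b - a" "c - b"] that by (simp add: less_hahn_def)
  have tot: "a < b \<or> a = b \<or> b < a" for a b :: "'a hahn"
    using hahn_pos_uminus[of "a - b"] by (auto simp: less_hahn_def)
  show "x < y \<longleftrightarrow> x \<le> y \<and> \<not> y \<le> x" using irr tr unfolding less_eq_hahn_def by metis
  show "x \<le> x" by (simp add: less_eq_hahn_def)
  show "x \<le> y \<Longrightarrow> y \<le> z \<Longrightarrow> x \<le> z" using tr unfolding less_eq_hahn_def by blast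
  show "x \<le> y \<Longrightarrow> y \<le> x \<Longrightarrow> x = y" using irr tr unfolding less_eq_hahn_def by metis
  show "x \<le> y \<or> y \<le> x" using tot unfolding less_eq_hahn_def by metis
  show "x \<le> y \<Longrightarrow> z + x \<le> z + y" by (auto simp: less_eq_hahn_def less_hahn_def)
qed

end

text \<open>The embedding of the fundamental monomials into the Hahn group.\<close>

definition fund :: "'a::linorder \<Rightarrow> 'a hahn" where
  "fund \<phi> = Abs_hahn (\<lambda>\<psi>. if \<psi> = \<phi> then 1 else 0)"

lemma expo_fund [simp]: "expo (fund \<phi>) \<psi> = (if \<psi> = \<phi> then 1 else 0)"
  by (simp add: fund_def Abs_hahn_inverse)

lemma fund_pos: "0 < fund \<phi>"
proof -
  have "max_supp (fund \<phi>) = \<phi>" by (rule max_supp_eqI) (auto simp: supp_def split: if_splits)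
  moreover have "fund \<phi> \<noteq> 0" by (metis expo_fund expo_zero zero_neq_one)
  ultimately show ?thesis by (simp add: less_hahn_def hahn_pos_def)
qed

lemma fund_less_iff [simp]: "fund \<phi> < fund \<psi> \<longleftrightarrow> \<phi> < \<psi>"
proof -
  have *: "fund a < fund b" if "a < b" for a b :: 'a
  proof -
    have "max_supp (fund b - fund a) = b"
      by (rule max_supp_eqI) (use that in \<open>auto simp: supp_def split: if_splits\<close>)
    moreover have "fund b - fund a \<noteq> 0"
      using that by (metis expo_fund less_irrefl right_minus_eq zero_neq_one)
    ultimately show ?thesis using that by (auto simp: less_hahn_def hahn_pos_def)
  qed
  show ?thesis using *[of \<phi> \<psi>] *[of \<psi> \<phi>] by (metis less_asym neqE)
qed

text \<open>
  Leading fundamental monomial. It takes values in the fundamental monomials together with 1,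
  both regarded as elements of the Hahn group.
\<close>

definition LF :: "'a::linorder hahn \<Rightarrow> 'a hahn" where
  "LF \<gamma> = (if \<gamma> = 0 then 0 else fund (max_supp \<gamma>))"

definition hahn_subgroup :: "'a::linorder hahn set \<Rightarrow> bool" where
  "hahn_subgroup \<Gamma> \<longleftrightarrow> 0 \<in> \<Gamma> \<and> (\<forall>\<alpha>\<in>\<Gamma>. \<forall>\<beta>\<in>\<Gamma>. \<alpha> + \<beta> \<in> \<Gamma>) \<and> (\<forall>\<alpha>\<in>\<Gamma>. - \<alpha> \<in> \<Gamma>)"


section \<open>Generalised series\<close>

text \<open>
  A series is given by its coefficients on the whole Hahn group; those of the field
  \<open>\<real>((\<Gamma>))\<close> are the ones with anti-well-ordered support contained in \<open>\<Gamma>\<close>.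
\<close>

type_synonym 'a series = "'a hahn \<Rightarrow> real"

definition Supp :: "'a::linorder series \<Rightarrow> 'a hahn set" where
  "Supp a = {\<alpha>. a \<alpha> \<noteq> 0}"

definition gen_series :: "'a::linorder hahn set \<Rightarrow> 'a series set" where
  "gen_series \<Gamma> = {a. Supp a \<subseteq> \<Gamma> \<and> anti_well_ordered (Supp a)}"

definition monom :: "'a::linorder hahn \<Rightarrow> 'a series" where
  "monom \<alpha> = (\<lambda>\<beta>. if \<beta> = \<alpha> then 1 else 0)"

text \<open>
  Convolution product. For anti-well-ordered supports the index set of the sum is finite.
\<close>

definition series_mult :: "'a::linorder series \<Rightarrow> 'a series \<Rightarrow> 'a series" (infixl "\<star>" 70) where
  "a \<star> b = (\<lambda>\<gamma>. \<Sum>(\<alpha>, \<beta>) \<in> {(\<alpha>, \<beta>). \<alpha> \<in> Supp a \<and> \<beta> \<in> Supp b \<and> \<alpha> + \<beta> = \<gamma>}. a \<alpha> * b \<beta>)"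

definition summable_family :: "'i set \<Rightarrow> ('i \<Rightarrow> 'a::linorder series) \<Rightarrow> bool" where
  "summable_family I a \<longleftrightarrow>
     anti_well_ordered (\<Union>i\<in>I. Supp (a i)) \<and> (\<forall>\<alpha>. finite {i \<in> I. \<alpha> \<in> Supp (a i)})"

definition family_sum :: "'i set \<Rightarrow> ('i \<Rightarrow> 'a::linorder series) \<Rightarrow> 'a series" where
  "family_sum I a = (\<lambda>\<alpha>. \<Sum>i\<in>{i \<in> I. \<alpha> \<in> Supp (a i)}. a i \<alpha>)"

lemma series_mult_monom: "(monom \<alpha> \<star> a) \<gamma> = a (\<gamma> - \<alpha>)"
proof -
  have "{(\<alpha>', \<beta>). \<alpha>' \<in> Supp (monom \<alpha>) \<and> \<beta> \<in> Supp a \<and> \<alpha>' + \<beta> = \<gamma>}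
      = (if a (\<gamma> - \<alpha>) = 0 then {} else {(\<alpha>, \<gamma> - \<alpha>)})"
    by (auto simp: Supp_def monom_def split: if_splits)
  then show ?thesis by (auto simp: series_mult_def monom_def)
qed


section \<open>Series derivations\<close>

text \<open>The logarithmic derivative \<open>\<phi>'/\<phi>\<close>.\<close>

definition log_deriv :: "('a::linorder \<Rightarrow> 'a series) \<Rightarrow> 'a \<Rightarrow> 'a series" where
  "log_deriv d \<phi> = d \<phi> \<star> monom (- fund \<phi>)"

definition SD1 :: "'a::linorder hahn set \<Rightarrow> ('a \<Rightarrow> 'a series) \<Rightarrow> bool" where
  "SD1 \<Gamma> d \<longleftrightarrow> (\<forall>\<alpha>\<in>\<Gamma>. summable_family (supp \<alpha>) (log_deriv d))"

definition deriv_monomial :: "('a::linorder \<Rightarrow> 'a series) \<Rightarrow> 'a hahn \<Rightarrow> 'a series" where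
  "deriv_monomial d \<alpha> =
     monom \<alpha> \<star> family_sum (supp \<alpha>) (\<lambda>\<phi> \<gamma>. expo \<alpha> \<phi> * log_deriv d \<phi> \<gamma>)"

lemma deriv_monomial_zero: "deriv_monomial d 0 = (\<lambda>_. 0)"
  by (rule ext) (simp add: deriv_monomial_def series_mult_monom family_sum_def)

definition SD2 :: "'a::linorder hahn set \<Rightarrow> ('a \<Rightarrow> 'a series) \<Rightarrow> bool" where
  "SD2 \<Gamma> d \<longleftrightarrow> (\<forall>a\<in>gen_series \<Gamma>. summable_family (Supp a) (deriv_monomial d))"

definition extends_to_series_derivation :: "'a::linorder hahn set \<Rightarrow> ('a \<Rightarrow> 'a series) \<Rightarrow> bool" where
  "extends_to_series_derivation \<Gamma> d \<longleftrightarrow> SD1 \<Gamma> d \<and> SD2 \<Gamma> d"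


section \<open>The isomorphisms between supports\<close>

text \<open>
  The decreasing order on \<open>A\<close>; for anti-well-ordered \<open>A\<close> it is a well-order whose class
  modulo order isomorphism is the order type of \<open>A\<close>.
\<close>

definition dec_order :: "'b::linorder set \<Rightarrow> 'b rel" where
  "dec_order A = {(x, y). x \<in> A \<and> y \<in> A \<and> y \<le> x}"

definition ot_le :: "'b::linorder set \<Rightarrow> 'b set \<Rightarrow> bool" where
  "ot_le A B \<longleftrightarrow> (dec_order A, dec_order B) \<in> ordLeq"

definition final_segment :: "'b::linorder set \<Rightarrow> 'b set \<Rightarrow> bool" where
  "final_segment S B \<longleftrightarrow> S \<subseteq> B \<and> (\<forall>x\<in>S. \<forall>y\<in>B. x \<le> y \<longrightarrow> y \<in> S)"

definition final_iso :: "'b::linorder set \<Rightarrow> 'b set \<Rightarrow> ('b \<Rightarrow> 'b) \<Rightarrow> bool" where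
  "final_iso A B f \<longleftrightarrow> strict_mono_on A f \<and> final_segment (f ` A) B"

lemma Field_dec_order [simp]: "Field (dec_order A) = A"
  by (auto simp: dec_order_def Field_def)

lemma Well_order_dec_order:
  assumes "anti_well_ordered A"
  shows "Well_order (dec_order A)"
proof -
  have "\<exists>m\<in>B. \<forall>x\<in>B. (m, x) \<in> dec_order A" if "B \<subseteq> A" "B \<noteq> {}" for B
  proof -
    obtain m where "m \<in> B" "\<forall>x\<in>B. x \<le> m"
      using assms \<open>B \<subseteq> A\<close> \<open>B \<noteq> {}\<close> unfolding anti_well_ordered_def by meson
    then show ?thesis using \<open>B \<subseteq> A\<close> by (auto simp: dec_order_def)
  qed
  moreover have "Linear_order (dec_order A)"
    unfolding linear_order_on_def partial_order_on_def preorder_on_def refl_on_def total_on_def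
      Field_dec_order
    by (auto simp: dec_order_def intro!: transI antisymI)
  ultimately show ?thesis
    using Linear_order_Well_order_iff[of "dec_order A"] unfolding Field_dec_order by blast
qed

lemma final_iso_iff_embed:
  assumes "anti_well_ordered A" and "anti_well_ordered B"
  shows "final_iso A B f \<longleftrightarrow> embed (dec_order A) (dec_order B) f"
proof -
  have wo: "wo_rel (dec_order B)"
    using Well_order_dec_order[OF assms(2)] by (simp add: wo_rel_def)
  have under: "under (dec_order B) x = {y \<in> B. x \<in> B \<and> x \<le> y}" for x
    by (auto simp: under_def dec_order_def)
  have ofilter: "wo_rel.ofilter (dec_order B) S \<longleftrightarrow> final_segment S B" for S
    unfolding wo_rel.ofilter_def[OF wo] final_segment_def Field_dec_order under by blast
  have mono: "compat (dec_order A) (dec_order B) f \<and> inj_on f A \<longleftrightarrow> strict_mono_on A f"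
    if "f ` A \<subseteq> B"
  proof -
    have fB: "f x \<in> B" if "x \<in> A" for x
      using that \<open>f ` A \<subseteq> B\<close> by blast
    have "compat (dec_order A) (dec_order B) f \<longleftrightarrow> mono_on A f"
      using fB by (auto simp: compat_def dec_order_def mono_on_def)
    moreover have "strict_mono_on A f" if "mono_on A f" "inj_on f A"
    proof (rule strict_mono_onI)
      fix x y assume "x \<in> A" "y \<in> A" "x < y"
      then show "f x < f y"
        using mono_onD[OF that(1), of x y] inj_onD[OF that(2), of x y] by (auto simp: order_less_le)
    qed
    ultimately show ?thesis
      using strict_mono_on_imp_mono_on strict_mono_on_imp_inj_on by blast
  qed
  have "f ` A \<subseteq> B" if "final_segment (f ` A) B"
    using that by (simp add: final_segment_def)
  then show ?thesis
    unfolding embed_iff_compat_inj_on_ofilter[OF Well_order_dec_order[OF assms(1)]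
        Well_order_dec_order[OF assms(2)]] Field_dec_order ofilter final_iso_def
    using mono by blast
qed

lemma ot_le_iff_final_iso:
  assumes "anti_well_ordered A" and "anti_well_ordered B"
  shows "ot_le A B \<longleftrightarrow> (\<exists>f. final_iso A B f)"
  using Well_order_dec_order[OF assms(1)] Well_order_dec_order[OF assms(2)]
  by (simp add: ot_le_def ordLeq_def final_iso_iff_embed[OF assms])

lemma ot_le_total:
  "anti_well_ordered A \<Longrightarrow> anti_well_ordered B \<Longrightarrow> ot_le A B \<or> ot_le B A"
  unfolding ot_le_def by (intro ordLeq_total Well_order_dec_order)

lemma final_iso_unique:
  assumes "anti_well_ordered A" and "anti_well_ordered B"
    and "final_iso A B f" and "final_iso A B g" and "x \<in> A"
  shows "f x = g x"
  using embed_unique[OF Well_order_dec_order[OF assms(1)] Well_order_dec_order[OF assms(2)], of f g]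
    assms by (simp add: final_iso_iff_embed)

text \<open>
  The partial map \<open>I\<close> from \<open>A\<close> to \<open>B\<close>, given by its graph. For anti-well-ordered sets the
  isomorphism onto a final segment is unique, so this is a single-valued relation.
\<close>

definition I_graph :: "'b::linorder set \<Rightarrow> 'b set \<Rightarrow> 'b rel" where
  "I_graph A B =
     (if ot_le A B then {(x, f x) | x f. x \<in> A \<and> final_iso A B f}
      else {(f y, y) | y f. y \<in> B \<and> final_iso B A f})"

lemma I_graph_eq:
  assumes "anti_well_ordered A" and "anti_well_ordered B" and "final_iso A B f"
  shows "I_graph A B = {(x, f x) | x. x \<in> A}"
proof -
  have "ot_le A B" using ot_le_iff_final_iso[OF assms(1,2)] assms(3) by blast
  then have "I_graph A B = {(x, g x) | x g. x \<in> A \<and> final_iso A B g}"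
    by (simp add: I_graph_def)
  moreover have "g x = f x" if "final_iso A B g" "x \<in> A" for g x
    by (rule final_iso_unique[OF assms(1,2) that(1) assms(3) that(2)])
  ultimately show ?thesis
    using assms(3) by (auto intro!: exI[of _ f])
qed

lemma I_graph_eq_converse:
  assumes "anti_well_ordered A" and "anti_well_ordered B" and "\<not> ot_le A B"
  shows "I_graph A B = (I_graph B A)\<inverse>"
  using ot_le_total[OF assms(1,2)] assms(3) by (auto simp: I_graph_def)

definition left_shift :: "'b::linorder rel \<Rightarrow> bool" where
  "left_shift R \<longleftrightarrow> (\<forall>(x, y)\<in>R. y < x)"

abbreviation I_iso :: "('a::linorder \<Rightarrow> 'a series) \<Rightarrow> 'a \<Rightarrow> 'a \<Rightarrow> 'a hahn rel" where
  "I_iso d \<mu> \<nu> \<equiv> I_graph (Supp (log_deriv d \<mu>)) (Supp (log_deriv d \<nu>))"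

end

theory Submission
  imports Defs "HOL-Library.Infinite_Set"
begin

text \<open>
  Summability can only fail along a sequence: if a family of series with anti-well-ordered
  supports is not summable, then there are pairwise distinct indices \<open>i\<^sub>n\<close> and elements
  \<open>\<gamma>\<^sub>n\<close> of the corresponding supports such that \<open>\<gamma>\<^sub>n\<close> is non-decreasing (lemma
  \<open>summable_family_or_bad_sequence\<close>). Both halves of the theorem refute such a sequence.

  \<^emph>\<open>Descending fundamental monomials.\<close> Let \<open>\<phi>\<^sub>n\<close> be strictly decreasing and
  \<open>\<tau>\<^sub>n \<in> Supp (\<phi>\<^sub>n'/\<phi>\<^sub>n)\<close>. Then \<open>\<tau>\<^sub>n\<close> is not non-decreasing (lemma
  \<open>no_bad_descending_sequence\<close>). Indeed the well-ordered set \<open>E\<^sub>1\<close> contains only finitely many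
  \<open>\<phi>\<^sub>n\<close>, so along a tail all isomorphisms from \<open>\<phi>\<^sub>m\<close> to a later \<open>\<phi>\<^sub>n\<close> are left shifts. The
  positions of the \<open>\<tau>\<^sub>n\<close> in the decreasing enumerations are ordinals, hence some
  \<open>m < n\<close> have \<open>\<tau>\<^sub>m\<close> at a position not later than that of \<open>\<tau>\<^sub>n\<close>. The element of
  \<open>Supp (\<phi>\<^sub>n'/\<phi>\<^sub>n)\<close> at the position of \<open>\<tau>\<^sub>m\<close> exists, is at least \<open>\<tau>\<^sub>n\<close>, and is less than
  \<open>\<tau>\<^sub>m\<close> by the left shift; so \<open>\<tau>\<^sub>n < \<tau>\<^sub>m\<close>.

  \<^emph>\<open>Derivatives of monomials.\<close> Infinitely many distinct \<open>\<phi>\<close> in the support of one monomial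
  contain a descending sequence, so (SD1) follows at once.

  \<^emph>\<open>Derivatives of series.\<close> A bad sequence for (SD2) can be taken of the form
  \<open>\<alpha>\<^sub>n + \<tau>\<^sub>n\<close> with \<open>\<alpha>\<^sub>n\<close> strictly decreasing, \<open>\<phi>\<^sub>n \<in> supp \<alpha>\<^sub>n\<close> and
  \<open>\<tau>\<^sub>n \<in> Supp (\<phi>\<^sub>n'/\<phi>\<^sub>n)\<close>. Then \<open>\<tau>\<^sub>n\<close> is strictly increasing, so no \<open>\<phi>\<close> occurs
  infinitely often, and \<open>\<phi>\<^sub>n\<close> may be taken strictly monotone; by the above it increases. Only
  finitely many \<open>\<phi>\<^sub>n\<close> lie in \<open>E\<^sub>2\<close>. For the others and \<open>m < n\<close>, the leading fundamental
  monomial of \<open>\<tau>\<^sub>m - \<tau>\<^sub>n\<close> is below \<open>\<phi>\<^sub>n\<close>; the estimate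
  \<open>0 < \<alpha>\<^sub>m - \<alpha>\<^sub>n \<le> \<tau>\<^sub>n - \<tau>\<^sub>m\<close> passes this on to \<open>\<alpha>\<^sub>m - \<alpha>\<^sub>n\<close>, so \<open>\<alpha>\<^sub>m\<close> and \<open>\<alpha>\<^sub>n\<close>
  have the same exponent at \<open>\<phi>\<^sub>n\<close>. Hence \<open>supp \<alpha>\<^sub>m\<close> contains all later \<open>\<phi>\<^sub>n\<close>, an
  infinite increasing sequence, which is impossible (lemma \<open>no_bad_ascending_sequence\<close>).
\<close>

section \<open>Sequences in linear orders\<close>

lemma anti_well_ordered_iff_no_strict_mono:
  "anti_well_ordered A \<longleftrightarrow> (\<nexists>f :: nat \<Rightarrow> 'b::linorder. strict_mono f \<and> range f \<subseteq> A)"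
proof
  assume A: "anti_well_ordered A"
  show "\<nexists>f :: nat \<Rightarrow> 'b. strict_mono f \<and> range f \<subseteq> A"
  proof
    assume "\<exists>f :: nat \<Rightarrow> 'b. strict_mono f \<and> range f \<subseteq> A"
    then obtain f :: "nat \<Rightarrow> 'b" where f: "strict_mono f" "range f \<subseteq> A" by blast
    have "\<exists>m\<in>range f. \<forall>x\<in>range f. x \<le> m"
      using A[unfolded anti_well_ordered_def, rule_format, OF f(2)] by blast
    then obtain n where "\<forall>x\<in>range f. x \<le> f n" by blast
    then show False
      using strict_monoD[OF f(1), of n "Suc n"] by (meson leD lessI rangeI)
  qed
next
  assume none: "\<nexists>f :: nat \<Rightarrow> 'b. strict_mono f \<and> range f \<subseteq> A"
  show "anti_well_ordered A"
  proof (rule ccontr)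
    assume "\<not> anti_well_ordered A"
    then obtain B where B: "B \<subseteq> A" "B \<noteq> {}" "\<forall>m\<in>B. \<exists>x\<in>B. m < x"
      unfolding anti_well_ordered_def by (meson not_le)
    have "\<exists>f. \<forall>n. f n \<in> B \<and> f n < f (Suc n)"
      by (rule dependent_nat_choice) (use B in auto)
    then obtain f where "\<forall>n. f n \<in> B \<and> f n < f (Suc n)" by blast
    then show False using none B(1) by (auto simp: strict_mono_Suc_iff)
  qed
qed

lemma anti_well_ordered_no_ascending_sequence:
  assumes "anti_well_ordered A" and "\<And>n :: nat. f n \<in> A"
  shows "\<not> strict_mono f"
  using assms unfolding anti_well_ordered_iff_no_strict_mono by (meson image_subsetI)

lemma well_ordered_no_descending_sequence:
  assumes "well_ordered A" and "\<And>n :: nat. f n \<in> A"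
  shows "\<exists>m n. m < n \<and> f m \<le> f n"
proof -
  have "range f \<subseteq> A" using assms(2) by blast
  then have "\<exists>m\<in>range f. \<forall>x\<in>range f. m \<le> x"
    using assms(1)[unfolded well_ordered_def, rule_format, of "range f"] by blast
  then obtain m where "\<And>n. f m \<le> f n" by blast
  then show ?thesis using lessI by blast
qed

lemma infinite_imp_strict_mono_enumeration:
  assumes "infinite (S :: nat set)"
  obtains r :: "nat \<Rightarrow> nat" where "strict_mono r" and "\<And>n. r n \<in> S"
  using assms strict_mono_enumerate enumerate_in_set by blast

lemma tail_avoiding:
  assumes "\<And>r :: nat \<Rightarrow> nat. strict_mono r \<Longrightarrow> \<not> (\<forall>n. P (r n))"
  shows "\<exists>N. \<forall>n\<ge>N. \<not> P n"
proof -
  have "finite {n. P n}"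
  proof (rule ccontr)
    assume "infinite {n. P n}"
    then obtain r :: "nat \<Rightarrow> nat" where r: "strict_mono r" "\<And>n. r n \<in> {n. P n}"
      using infinite_imp_strict_mono_enumeration by blast
    then show False using assms[OF r(1)] by simp
  qed
  then obtain N where "\<forall>n\<in>{n. P n}. n < N"
    using finite_nat_set_iff_bounded by blast
  then have "\<not> P n" if "n \<ge> N" for n
    using that by (meson leD mem_Collect_eq)
  then show ?thesis by blast
qed

lemma strict_mono_or_antimono_subsequence:
  fixes f :: "nat \<Rightarrow> 'b::linorder"
  assumes "inj f"
  obtains r :: "nat \<Rightarrow> nat" where "strict_mono r" and "strict_mono (f \<circ> r)"
  | r :: "nat \<Rightarrow> nat" where "strict_mono r" and "\<And>m n. m < n \<Longrightarrow> f (r n) < f (r m)"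
proof -
  obtain r :: "nat \<Rightarrow> nat" where r: "strict_mono r" "monoseq (\<lambda>n. f (r n))"
    using seq_monosub[of f] by blast
  have neq: "f (r m) \<noteq> f (r n)" if "m < n" for m n
    using strict_monoD[OF r(1) that] assms by (auto dest: injD)
  consider "\<forall>m. \<forall>n\<ge>m. f (r m) \<le> f (r n)" | "\<forall>m. \<forall>n\<ge>m. f (r n) \<le> f (r m)"
    using r(2) unfolding monoseq_def by blast
  then show thesis
  proof cases
    case 1
    then have "strict_mono (f \<circ> r)"
      using neq by (auto simp: strict_mono_def less_le)
    then show thesis using that(1) r(1) by blast
  next
    case 2
    then have "f (r n) < f (r m)" if "m < n" for m n
      using that neq[OF that] by (auto simp: less_le)
    then show thesis using that(2) r(1) by blast
  qed
qed

text \<open>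
  Infinitely many members of a strictly increasing sequence cannot come from one anti-well-ordered
  set; hence the index runs through infinitely many values, and its first occurrences give the
  required subsequence.
\<close>

lemma injective_index_subsequence:
  fixes f :: "nat \<Rightarrow> 'b::linorder"
  assumes f: "strict_mono f" and L: "\<And>n. f n \<in> L (i n)" and awo: "\<And>n. anti_well_ordered (L (i n))"
  obtains r :: "nat \<Rightarrow> nat" where "strict_mono r" and "inj (i \<circ> r)"
proof -
  have "infinite (range i)"
  proof
    assume "finite (range i)"
    then obtain k where "infinite {n. i n = i k}"
      using pigeonhole_infinite[of UNIV i] by auto
    then obtain r :: "nat \<Rightarrow> nat" where r: "strict_mono r" "\<And>n. r n \<in> {n. i n = i k}"
      using infinite_imp_strict_mono_enumeration by blast
    have "strict_mono (f \<circ> r)" using f r(1) by (simp add: strict_mono_o)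
    moreover have "(f \<circ> r) n \<in> L (i k)" for n
      using L[of "r n"] r(2)[of n] by simp
    ultimately show False
      using anti_well_ordered_no_ascending_sequence[OF awo, of "f \<circ> r" k] by blast
  qed
  moreover define S where "S = {n. \<forall>k<n. i k \<noteq> i n}"
  have "range i \<subseteq> i ` S"
  proof
    fix j assume "j \<in> range i"
    then have ex: "\<exists>n. i n = j" by blast
    have "i (LEAST n. i n = j) = j" using ex by (rule LeastI_ex)
    moreover from this have "(LEAST n. i n = j) \<in> S"
      unfolding S_def using not_less_Least by auto
    ultimately show "j \<in> i ` S" by (metis imageI)
  qed
  ultimately have "infinite S" by (meson finite_surj)
  then obtain r :: "nat \<Rightarrow> nat" where r: "strict_mono r" "\<And>n. r n \<in> S"
    using infinite_imp_strict_mono_enumeration by blast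
  have "i (r m) \<noteq> i (r n)" if "m < n" for m n
    using r(2)[of n] strict_monoD[OF r(1) that] by (simp add: S_def)
  then have "inj (i \<circ> r)" by (intro injI) (metis comp_apply linorder_neqE_nat)
  then show thesis using that r(1) by blast
qed

section \<open>Failure of summability\<close>

text \<open>
  The two ways to violate summability give the two kinds of non-decreasing sequences: a union of
  supports that is not anti-well-ordered gives a strictly increasing one, in which each index
  accounts for finitely many terms only, and an element of infinitely many supports gives a
  constant one.
\<close>

lemma summable_family_or_bad_sequence:
  assumes awo: "\<And>i. i \<in> I \<Longrightarrow> anti_well_ordered (Supp (a i))"
  obtains "summable_family I a"
  | i \<gamma> where "inj i" and "\<And>n::nat. i n \<in> I" and "\<And>n. \<gamma> n \<in> Supp (a (i n))" and "mono \<gamma>"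
proof -
  consider "summable_family I a" | "\<not> anti_well_ordered (\<Union>i\<in>I. Supp (a i))"
    | \<alpha> where "infinite {i \<in> I. \<alpha> \<in> Supp (a i)}"
    unfolding summable_family_def by blast
  then show thesis
  proof cases
    case 1
    then show thesis by (rule that(1))
  next
    case 2
    then obtain f :: "nat \<Rightarrow> _" where f: "strict_mono f" "range f \<subseteq> (\<Union>i\<in>I. Supp (a i))"
      unfolding anti_well_ordered_iff_no_strict_mono by blast
    then have "\<forall>n. \<exists>i. i \<in> I \<and> f n \<in> Supp (a i)" by blast
    then obtain i where i: "\<And>n. i n \<in> I" "\<And>n. f n \<in> Supp (a (i n))" by metis
    obtain r :: "nat \<Rightarrow> nat" where r: "strict_mono r" "inj (i \<circ> r)"
      using injective_index_subsequence[of f "\<lambda>i. Supp (a i)" i] f(1) i awo by blast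
    have "mono (f \<circ> r)"
      using f(1) r(1) by (simp add: strict_mono_mono strict_mono_o)
    then show thesis using that(2)[of "i \<circ> r" "f \<circ> r"] r(2) i by simp
  next
    case 3
    then obtain i :: "nat \<Rightarrow> _" where i: "inj i" "range i \<subseteq> {i \<in> I. \<alpha> \<in> Supp (a i)}"
      using infinite_countable_subset by blast
    show thesis
    proof (rule that(2)[of i "\<lambda>_. \<alpha>"])
      show "i n \<in> I" "\<alpha> \<in> Supp (a (i n))" for n
        using i(2) by blast+
    qed (use i(1) in \<open>auto simp: mono_def\<close>)
  qed
qed

section \<open>Left shifts and positions\<close>

lemma final_iso_subset:
  assumes "final_iso A B f" and "final_segment S A"
  shows "final_iso S B f"
proof -
  have f: "strict_mono_on A f" "final_segment (f ` A) B"
    using assms(1) by (auto simp: final_iso_def)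
  have S: "S \<subseteq> A" using assms(2) by (simp add: final_segment_def)
  have "y \<in> f ` S" if "x \<in> S" "y \<in> B" "f x \<le> y" for x y
  proof -
    have x: "x \<in> A" using S that(1) by blast
    then have "y \<in> f ` A" using f(2) that(2,3) by (auto simp: final_segment_def)
    then obtain z where z: "z \<in> A" "y = f z" by blast
    have "x \<le> z"
    proof (rule ccontr)
      assume "\<not> x \<le> z"
      then have "f z < f x" using strict_mono_onD[OF f(1) z(1) x] by simp
      then show False using that(3) z(2) by simp
    qed
    then have "z \<in> S" using assms(2) z(1) that(1) by (auto simp: final_segment_def)
    then show ?thesis using z(2) by blast
  qed
  moreover have "f ` S \<subseteq> B" using f(2) S by (auto simp: final_segment_def)
  moreover have "strict_mono_on S f"
    using f(1) S by (meson monotone_on_subset)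
  ultimately show ?thesis by (auto simp: final_iso_def final_segment_def)
qed

lemma final_segment_trans:
  assumes T: "final_segment T S" and S: "final_segment S B"
  shows "final_segment T B"
  unfolding final_segment_def
proof (intro conjI ballI impI)
  have sub: "T \<subseteq> S" "S \<subseteq> B" using T S by (simp_all add: final_segment_def)
  then show "T \<subseteq> B" by (rule order_trans)
  fix x y assume xy: "x \<in> T" "y \<in> B" "x \<le> y"
  then have "y \<in> S" using S sub by (auto simp: final_segment_def)
  then show "y \<in> T" using T xy by (auto simp: final_segment_def)
qed

lemma final_iso_into_superset:
  "final_iso A S f \<Longrightarrow> final_segment S B \<Longrightarrow> final_iso A B f"
  unfolding final_iso_def by (blast intro: final_segment_trans)

lemma final_iso_compose:
  assumes f: "final_iso A B f" and g: "final_iso B C g"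
  shows "final_iso A C (g \<circ> f)"
proof -
  have fA: "final_segment (f ` A) B" using f by (simp add: final_iso_def)
  then have "f ` A \<subseteq> B" by (simp add: final_segment_def)
  then have "strict_mono_on A (g \<circ> f)"
    using f g unfolding final_iso_def strict_mono_on_def by (simp add: image_subset_iff)
  moreover have "final_segment (g ` f ` A) C"
    using final_iso_subset[OF g fA] by (simp add: final_iso_def)
  ultimately show ?thesis by (simp add: final_iso_def image_comp)
qed

text \<open>
  The sets of elements above \<open>x\<close> and above \<open>y\<close> encode the positions of \<open>x\<close> in \<open>A\<close> and of \<open>y\<close>
  in \<open>B\<close>. An isomorphism between them must agree with \<open>I\<close> by uniqueness, whichever of the two
  directions defines \<open>I\<close>; so \<open>I\<close> is defined at \<open>x\<close>, and its value there is at least \<open>y\<close>.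
\<close>

lemma left_shift_imp_less:
  assumes A: "anti_well_ordered A" and B: "anti_well_ordered B" and x: "x \<in> A"
    and pos: "ot_le {u \<in> A. x \<le> u} {u \<in> B. y \<le> u}" and shift: "left_shift (I_graph A B)"
  shows "y < x"
proof -
  let ?U = "{u \<in> A. x \<le> u}" and ?V = "{u \<in> B. y \<le> u}"
  have U: "anti_well_ordered ?U" and V: "anti_well_ordered ?V"
    using A B by (auto intro: anti_well_ordered_subset)
  have fsU: "final_segment ?U A" and fsV: "final_segment ?V B"
    by (auto simp: final_segment_def)
  obtain f where f: "final_iso ?U ?V f"
    using pos ot_le_iff_final_iso[OF U V] by blast
  then have fx: "f x \<in> B" "y \<le> f x"
    using x by (auto simp: final_iso_def final_segment_def)
  have fB: "final_iso ?U B f" by (rule final_iso_into_superset[OF f fsV])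
  have "(x, f x) \<in> I_graph A B"
  proof (cases "ot_le A B")
    case True
    then obtain g where g: "final_iso A B g"
      using ot_le_iff_final_iso[OF A B] by blast
    have "f x = g x"
      using final_iso_unique[OF U B fB final_iso_subset[OF g fsU]] x by simp
    then show ?thesis using I_graph_eq[OF A B g] x by auto
  next
    case False
    then obtain g where g: "final_iso B A g"
      using ot_le_total[OF A B] ot_le_iff_final_iso[OF B A] by blast
    have "final_iso ?U A id"
      using fsU by (simp add: final_iso_def strict_mono_on_def)
    then have "(g \<circ> f) x = id x"
      using final_iso_unique[OF U A final_iso_compose[OF fB g]] x by simp
    then have "g (f x) = x" by simp
    moreover have "(f x, g (f x)) \<in> I_graph B A" using I_graph_eq[OF B A g] fx(1) by auto
    ultimately show ?thesis using I_graph_eq_converse[OF A B False] by simp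
  qed
  then have "f x < x" using shift by (auto simp: left_shift_def)
  then show ?thesis using fx(2) by simp
qed

text \<open>
  Strict comparison of well-orders is well-founded, so the order types cannot decrease at every
  step.
\<close>

lemma order_types_not_descending:
  fixes U :: "nat \<Rightarrow> 'b::linorder set"
  assumes "\<And>n. anti_well_ordered (U n)"
  obtains m n where "m < n" and "ot_le (U m) (U n)"
proof -
  have wo: "Well_order (dec_order (U n))" for n
    by (rule Well_order_dec_order[OF assms])
  have "\<nexists>f :: nat \<Rightarrow> 'b rel. \<forall>n. (f (Suc n), f n) \<in> ordLess"
    using wf_ordLess by (simp add: wf_iff_no_infinite_down_chain)
  then have "\<not> (\<forall>n. (dec_order (U (Suc n)), dec_order (U n)) \<in> ordLess)"
    by (auto dest: spec[of _ "\<lambda>n. dec_order (U n)"])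
  then obtain n where "(dec_order (U (Suc n)), dec_order (U n)) \<notin> ordLess" by blast
  then have "ot_le (U n) (U (Suc n))"
    using not_ordLess_iff_ordLeq[OF wo wo] by (simp add: ot_le_def)
  then show thesis using that by blast
qed

text \<open>
  Some later term sits at a position at least as far down as that of an earlier one, and there the
  left shift has pushed the elements strictly down.
\<close>

lemma no_bad_descending_sequence:
  fixes L :: "'a::linorder \<Rightarrow> 'b::linorder set" and \<phi> :: "nat \<Rightarrow> 'a"
  assumes awo: "\<And>\<phi>. anti_well_ordered (L \<phi>)"
    and E1: "well_ordered {\<phi>. \<exists>\<psi>>\<phi>. \<not> left_shift (I_graph (L \<psi>) (L \<phi>))}"
    and dec: "\<And>m n. m < n \<Longrightarrow> \<phi> n < \<phi> m"
    and \<tau>: "\<And>n. \<tau> n \<in> L (\<phi> n)"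
  shows "\<not> mono \<tau>"
proof
  assume mono: "mono \<tau>"
  let ?E = "{\<phi>. \<exists>\<psi>>\<phi>. \<not> left_shift (I_graph (L \<psi>) (L \<phi>))}"
  have "\<exists>N. \<forall>n\<ge>N. \<phi> n \<notin> ?E"
  proof (rule tail_avoiding)
    fix r :: "nat \<Rightarrow> nat" assume r: "strict_mono r"
    have "\<not> (\<exists>m n. m < n \<and> \<phi> (r m) \<le> \<phi> (r n))"
      using dec strict_monoD[OF r] by (meson leD)
    then show "\<not> (\<forall>n. \<phi> (r n) \<in> ?E)"
      using well_ordered_no_descending_sequence[OF E1, of "\<lambda>n. \<phi> (r n)"] by blast
  qed
  then obtain N where N: "\<And>n. n \<ge> N \<Longrightarrow> \<phi> n \<notin> ?E" by blast
  have pos_awo: "anti_well_ordered {u \<in> L (\<phi> n). \<tau> n \<le> u}" for n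
    by (rule anti_well_ordered_subset[OF awo[of "\<phi> n"]]) simp
  obtain m n where mn: "m < n"
    and pos: "ot_le {u \<in> L (\<phi> (N + m)). \<tau> (N + m) \<le> u} {u \<in> L (\<phi> (N + n)). \<tau> (N + n) \<le> u}"
    by (rule order_types_not_descending[of "\<lambda>n. {u \<in> L (\<phi> (N + n)). \<tau> (N + n) \<le> u}",
          OF pos_awo])
  have "left_shift (I_graph (L (\<phi> (N + m))) (L (\<phi> (N + n))))"
    using N[of "N + n"] dec[of "N + m" "N + n"] mn by auto
  then have "\<tau> (N + n) < \<tau> (N + m)"
    by (rule left_shift_imp_less[OF awo awo \<tau> pos])
  moreover have "\<tau> (N + m) \<le> \<tau> (N + n)" using monoD[OF mono] mn by simp
  ultimately show False by simp
qed

section \<open>Supports of derivatives\<close>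

lemma anti_well_ordered_translate:
  fixes A :: "'b::linordered_ab_group_add set"
  assumes "anti_well_ordered A"
  shows "anti_well_ordered ((+) c ` A)"
  unfolding anti_well_ordered_iff_no_strict_mono
proof
  assume "\<exists>f :: nat \<Rightarrow> 'b. strict_mono f \<and> range f \<subseteq> (+) c ` A"
  then obtain f :: "nat \<Rightarrow> 'b" where f: "strict_mono f" "range f \<subseteq> (+) c ` A" by blast
  have "strict_mono (\<lambda>n. f n - c)" using f(1) by (simp add: strict_mono_def)
  moreover have "range (\<lambda>n. f n - c) \<subseteq> A" using f(2) by fastforce
  ultimately show False using assms unfolding anti_well_ordered_iff_no_strict_mono by blast
qed

lemma Supp_mult_monom_subset: "Supp (a \<star> monom \<beta>) \<subseteq> (+) \<beta> ` Supp a"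
proof
  fix \<gamma> assume "\<gamma> \<in> Supp (a \<star> monom \<beta>)"
  then have "{(\<alpha>, \<delta>). \<alpha> \<in> Supp a \<and> \<delta> \<in> Supp (monom \<beta>) \<and> \<alpha> + \<delta> = \<gamma>} \<noteq> {}"
    unfolding Supp_def series_mult_def by (metis (mono_tags, lifting) mem_Collect_eq sum.empty)
  then show "\<gamma> \<in> (+) \<beta> ` Supp a"
    by (auto simp: Supp_def monom_def add.commute split: if_splits)
qed

lemma anti_well_ordered_Supp_log_deriv:
  assumes "d \<phi> \<in> gen_series \<Gamma>"
  shows "anti_well_ordered (Supp (log_deriv d \<phi>))"
proof -
  have "anti_well_ordered (Supp (d \<phi>))" using assms by (simp add: gen_series_def)
  then show ?thesis
    unfolding log_deriv_def
    by (rule anti_well_ordered_subset[OF anti_well_ordered_translate Supp_mult_monom_subset])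
qed

lemma Supp_deriv_monomial_subset:
  "Supp (deriv_monomial d \<alpha>) \<subseteq> (+) \<alpha> ` (\<Union>\<phi>\<in>supp \<alpha>. Supp (log_deriv d \<phi>))"
proof
  fix \<gamma> assume "\<gamma> \<in> Supp (deriv_monomial d \<alpha>)"
  then have "family_sum (supp \<alpha>) (\<lambda>\<phi> \<gamma>. expo \<alpha> \<phi> * log_deriv d \<phi> \<gamma>) (\<gamma> - \<alpha>) \<noteq> 0"
    by (simp add: Supp_def deriv_monomial_def series_mult_monom)
  then obtain \<phi> where "\<phi> \<in> supp \<alpha>" "log_deriv d \<phi> (\<gamma> - \<alpha>) \<noteq> 0"
    unfolding family_sum_def by (force dest: sum.not_neutral_contains_not_neutral)
  then have "\<gamma> - \<alpha> \<in> (\<Union>\<phi>\<in>supp \<alpha>. Supp (log_deriv d \<phi>))" by (auto simp: Supp_def)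
  moreover have "\<gamma> = \<alpha> + (\<gamma> - \<alpha>)" by simp
  ultimately show "\<gamma> \<in> (+) \<alpha> ` (\<Union>\<phi>\<in>supp \<alpha>. Supp (log_deriv d \<phi>))" by blast
qed

section \<open>Comparison of leading fundamental monomials\<close>

text \<open>
  Otherwise the exponent of \<open>\<gamma>\<close> at its leading fundamental monomial, a positive number,
  would still decide the sign of \<open>\<gamma> - \<delta>\<close>.
\<close>

lemma max_supp_mono:
  assumes "0 < \<gamma>" and "\<gamma> \<le> \<delta>"
  shows "max_supp \<gamma> \<le> max_supp \<delta>"
proof (rule ccontr)
  assume "\<not> max_supp \<gamma> \<le> max_supp \<delta>"
  then have lt: "max_supp \<delta> < max_supp \<gamma>" by simp
  have \<gamma>: "\<gamma> \<noteq> 0" "expo \<gamma> (max_supp \<gamma>) > 0"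
    using assms(1) by (auto simp: less_hahn_def hahn_pos_def)
  have \<delta>: "\<delta> \<noteq> 0" using less_le_trans[OF assms] by simp
  have zero: "expo \<delta> \<psi> = 0" if "max_supp \<gamma> \<le> \<psi>" for \<psi>
    using max_supp(2)[OF \<delta>, of \<psi>] that lt by (force simp: supp_def)
  have exp: "expo (\<gamma> - \<delta>) (max_supp \<gamma>) = expo \<gamma> (max_supp \<gamma>)"
    using zero by simp
  have "max_supp (\<gamma> - \<delta>) = max_supp \<gamma>"
  proof (rule max_supp_eqI)
    show "max_supp \<gamma> \<in> supp (\<gamma> - \<delta>)" using exp \<gamma>(2) by (simp add: supp_def)
    show "\<psi> \<le> max_supp \<gamma>" if "\<psi> \<in> supp (\<gamma> - \<delta>)" for \<psi>
      using that zero[of \<psi>] max_supp(2)[OF \<gamma>(1), of \<psi>] by (force simp: supp_def)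
  qed
  then have "hahn_pos (\<gamma> - \<delta>)"
    using exp \<gamma>(2) unfolding hahn_pos_def by (metis expo_zero less_irrefl)
  then have "\<delta> < \<gamma>" by (simp add: less_hahn_def)
  then show False using assms(2) by simp
qed

section \<open>The two summability conditions\<close>

lemma summable_log_derivs:
  assumes awo: "\<And>\<phi>. anti_well_ordered (Supp (log_deriv d \<phi>))"
    and E1: "well_ordered {\<phi>. \<exists>\<psi>>\<phi>. \<not> left_shift (I_iso d \<psi> \<phi>)}"
    and S: "anti_well_ordered S"
  shows "summable_family S (log_deriv d)"
proof (rule summable_family_or_bad_sequence[OF awo])
  fix \<phi> :: "nat \<Rightarrow> _" and \<tau> :: "nat \<Rightarrow> _"
  assume \<phi>: "inj \<phi>" "\<And>n. \<phi> n \<in> S" and \<tau>: "\<And>n. \<tau> n \<in> Supp (log_deriv d (\<phi> n))" "mono \<tau>"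
  show ?thesis
  proof (rule strict_mono_or_antimono_subsequence[OF \<phi>(1)])
    fix r :: "nat \<Rightarrow> nat" assume "strict_mono (\<phi> \<circ> r)"
    then show ?thesis
      using anti_well_ordered_no_ascending_sequence[OF S, of "\<phi> \<circ> r"] \<phi>(2) by simp
  next
    fix r :: "nat \<Rightarrow> nat"
    assume r: "strict_mono r" "\<And>m n. m < n \<Longrightarrow> \<phi> (r n) < \<phi> (r m)"
    have "mono (\<lambda>n. \<tau> (r n))"
      using \<tau>(2) strict_mono_mono[OF r(1)] by (simp add: mono_def)
    then show ?thesis
      using no_bad_descending_sequence[OF awo E1, of "\<lambda>n. \<phi> (r n)" "\<lambda>n. \<tau> (r n)"] r(2) \<tau>(1)
      by blast
  qed
qed

text \<open>
  Once the \<open>\<phi>\<^sub>n\<close> have left \<open>E\<^sub>2\<close>, from an index \<open>N\<close> on, the monomials \<open>\<alpha>\<^sub>N\<close> and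
  \<open>\<alpha>\<^sub>n\<close> are so close to each other that \<open>\<phi>\<^sub>n\<close> belongs to the support of both. This makes
  the support of the single monomial \<open>\<alpha>\<^sub>N\<close> contain an increasing sequence.
\<close>

lemma no_bad_ascending_sequence:
  fixes L :: "'a::linorder \<Rightarrow> 'a hahn set" and \<phi> :: "nat \<Rightarrow> 'a"
  assumes E2: "anti_well_ordered
        {\<psi>. \<exists>\<phi><\<psi>. \<exists>\<tau>\<^sub>\<phi>\<in>L \<phi>. \<exists>\<tau>\<^sub>\<psi>\<in>L \<psi>. LF (\<tau>\<^sub>\<phi> - \<tau>\<^sub>\<psi>) \<ge> fund \<psi>}"
    and inc: "strict_mono \<phi>"
    and \<tau>: "\<And>n. \<tau> n \<in> L (\<phi> n)"
    and \<phi>: "\<And>n. \<phi> n \<in> supp (\<alpha> n)"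
    and dec: "\<And>m n. m < n \<Longrightarrow> \<alpha> n < \<alpha> m"
  shows "\<not> mono (\<lambda>n. \<alpha> n + \<tau> n)"
proof
  assume mono: "mono (\<lambda>n. \<alpha> n + \<tau> n)"
  let ?E = "{\<psi>. \<exists>\<phi><\<psi>. \<exists>\<tau>\<^sub>\<phi>\<in>L \<phi>. \<exists>\<tau>\<^sub>\<psi>\<in>L \<psi>. LF (\<tau>\<^sub>\<phi> - \<tau>\<^sub>\<psi>) \<ge> fund \<psi>}"
  have "\<exists>N. \<forall>n\<ge>N. \<phi> n \<notin> ?E"
  proof (rule tail_avoiding)
    fix r :: "nat \<Rightarrow> nat" assume r: "strict_mono r"
    show "\<not> (\<forall>n. \<phi> (r n) \<in> ?E)"
    proof
      assume "\<forall>n. \<phi> (r n) \<in> ?E"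
      then have "\<not> strict_mono (\<lambda>n. \<phi> (r n))"
        by (intro anti_well_ordered_no_ascending_sequence[OF E2]) (rule spec)
      then show False using strict_mono_o[OF inc r] by (simp add: comp_def)
    qed
  qed
  then obtain N where N: "\<And>n. n \<ge> N \<Longrightarrow> \<phi> n \<notin> ?E" by blast
  have "\<phi> n \<in> supp (\<alpha> N)" if n: "N < n" for n
  proof -
    have le: "\<alpha> N - \<alpha> n \<le> \<tau> n - \<tau> N"
      using monoD[OF mono, of N n] n by (simp add: algebra_simps)
    have pos: "0 < \<alpha> N - \<alpha> n" using dec[OF n] by simp
    have "0 < \<tau> n - \<tau> N" using pos le by (rule less_le_trans)
    then have neq: "\<tau> N - \<tau> n \<noteq> 0" by auto
    have "\<phi> N < \<phi> n" using strict_monoD[OF inc n] .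
    then have "LF (\<tau> N - \<tau> n) < fund (\<phi> n)"
      using N[of n] n \<tau> by (auto simp: not_le)
    then have "max_supp (\<tau> N - \<tau> n) < \<phi> n" using neq by (simp add: LF_def)
    moreover have "max_supp (\<tau> n - \<tau> N) = max_supp (\<tau> N - \<tau> n)"
      using max_supp_uminus[of "\<tau> N - \<tau> n"] by simp
    ultimately have "max_supp (\<alpha> N - \<alpha> n) < \<phi> n"
      using max_supp_mono[OF pos le] by simp
    then have "\<phi> n \<notin> supp (\<alpha> N - \<alpha> n)"
      using max_supp(2)[of "\<alpha> N - \<alpha> n" "\<phi> n"] pos by force
    then show ?thesis using \<phi>[of n] by (simp add: supp_def)
  qed
  then have "\<not> strict_mono (\<lambda>n. \<phi> (Suc (N + n)))"
    by (intro anti_well_ordered_no_ascending_sequence[OF anti_well_ordered_supp[of "\<alpha> N"]]) simp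
  moreover have "strict_mono (\<lambda>n. \<phi> (Suc (N + n)))"
    by (intro strict_monoI strict_monoD[OF inc]) simp
  ultimately show False by simp
qed

lemma summable_deriv_monomials:
  assumes awo: "\<And>\<phi>. anti_well_ordered (Supp (log_deriv d \<phi>))"
    and E1: "well_ordered {\<phi>. \<exists>\<psi>>\<phi>. \<not> left_shift (I_iso d \<psi> \<phi>)}"
    and E2: "anti_well_ordered {\<psi>. \<exists>\<phi><\<psi>. \<exists>\<tau>\<^sub>\<phi>\<in>Supp (log_deriv d \<phi>).
               \<exists>\<tau>\<^sub>\<psi>\<in>Supp (log_deriv d \<psi>). LF (\<tau>\<^sub>\<phi> - \<tau>\<^sub>\<psi>) \<ge> fund \<psi>}"
    and A: "anti_well_ordered A"
  shows "summable_family A (deriv_monomial d)"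
proof -
  have awo': "anti_well_ordered (Supp (deriv_monomial d \<alpha>))" for \<alpha>
  proof -
    have "anti_well_ordered (\<Union>\<phi>\<in>supp \<alpha>. Supp (log_deriv d \<phi>))"
      using summable_log_derivs[OF awo E1 anti_well_ordered_supp] by (simp add: summable_family_def)
    then show ?thesis
      by (rule anti_well_ordered_subset[OF anti_well_ordered_translate Supp_deriv_monomial_subset])
  qed
  show ?thesis
  proof (rule summable_family_or_bad_sequence[OF awo'])
    fix \<alpha> :: "nat \<Rightarrow> _" and \<gamma>
    assume \<alpha>: "inj \<alpha>" "\<And>n. \<alpha> n \<in> A"
      and \<gamma>: "\<And>n. \<gamma> n \<in> Supp (deriv_monomial d (\<alpha> n))" "mono \<gamma>"
    obtain r :: "nat \<Rightarrow> nat" where r: "strict_mono r" "\<And>m n. m < n \<Longrightarrow> \<alpha> (r n) < \<alpha> (r m)"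
    proof (rule strict_mono_or_antimono_subsequence[OF \<alpha>(1)])
      fix r :: "nat \<Rightarrow> nat" assume "strict_mono (\<alpha> \<circ> r)"
      then show thesis
        using anti_well_ordered_no_ascending_sequence[OF A, of "\<alpha> \<circ> r"] \<alpha>(2) by simp
    next
      fix r :: "nat \<Rightarrow> nat" assume "strict_mono r" "\<And>m n. m < n \<Longrightarrow> \<alpha> (r n) < \<alpha> (r m)"
      then show thesis by (rule that)
    qed
    have "\<forall>n. \<exists>\<phi> \<tau>. \<phi> \<in> supp (\<alpha> (r n)) \<and> \<tau> \<in> Supp (log_deriv d \<phi>) \<and> \<gamma> (r n) = \<alpha> (r n) + \<tau>"
      using \<gamma>(1) Supp_deriv_monomial_subset by fast
    then obtain \<phi> \<tau> where \<phi>: "\<And>n. \<phi> n \<in> supp (\<alpha> (r n))"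
      and \<tau>: "\<And>n. \<tau> n \<in> Supp (log_deriv d (\<phi> n))"
      and eq: "\<And>n. \<gamma> (r n) = \<alpha> (r n) + \<tau> n"
      by metis
    have mono: "\<alpha> (r m) + \<tau> m \<le> \<alpha> (r n) + \<tau> n" if "m \<le> n" for m n
      using monoD[OF \<gamma>(2), of "r m" "r n"] that strict_mono_less_eq[OF r(1)] by (simp add: eq)
    \<comment> \<open>Since \<open>\<alpha>\<close> decreases along \<open>r\<close>, only an increase of \<open>\<tau>\<close> can keep the sums from
      decreasing.\<close>
    have \<tau>_inc: "strict_mono \<tau>"
    proof (rule strict_monoI)
      fix m n :: nat assume "m < n"
      show "\<tau> m < \<tau> n"
      proof (rule ccontr)
        assume "\<not> \<tau> m < \<tau> n"
        then have "\<alpha> (r n) + \<tau> n < \<alpha> (r m) + \<tau> m"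
          using r(2)[OF \<open>m < n\<close>] by (intro add_less_le_mono) auto
        then show False using mono[of m n] \<open>m < n\<close> by simp
      qed
    qed
    \<comment> \<open>A value of \<open>\<phi>\<close> occurring infinitely often would put an increasing sequence into one
      support.\<close>
    obtain s :: "nat \<Rightarrow> nat" where s: "strict_mono s" "inj (\<phi> \<circ> s)"
      using injective_index_subsequence[of \<tau> "\<lambda>\<phi>. Supp (log_deriv d \<phi>)" \<phi>] \<tau>_inc \<tau> awo by blast
    show ?thesis
    proof (rule strict_mono_or_antimono_subsequence[OF s(2)])
      fix t :: "nat \<Rightarrow> nat" assume t: "strict_mono t" "strict_mono (\<phi> \<circ> s \<circ> t)"
      have st: "strict_mono (s \<circ> t)" by (rule strict_mono_o[OF s(1) t(1)])
      have "mono (\<lambda>n. \<alpha> (r (s (t n))) + \<tau> (s (t n)))"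
        using mono strict_mono_less_eq[OF st] by (simp add: mono_def)
      moreover have "\<alpha> (r (s (t n))) < \<alpha> (r (s (t m)))" if "m < n" for m n
        using r(2) strict_monoD[OF st that] by simp
      ultimately show ?thesis
        using no_bad_ascending_sequence[OF E2 t(2), of "\<lambda>n. \<tau> (s (t n))" "\<lambda>n. \<alpha> (r (s (t n)))"]
          \<phi> \<tau> by simp
    next
      fix t :: "nat \<Rightarrow> nat"
      assume t: "strict_mono t" "\<And>m n. m < n \<Longrightarrow> (\<phi> \<circ> s) (t n) < (\<phi> \<circ> s) (t m)"
      have "strict_mono (\<tau> \<circ> (s \<circ> t))"
        by (intro strict_mono_o \<tau>_inc s(1) t(1))
      then have "mono (\<tau> \<circ> (s \<circ> t))" by (rule strict_mono_mono)
      then show ?thesis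
        using no_bad_descending_sequence[OF awo E1, of "\<phi> \<circ> s \<circ> t" "\<tau> \<circ> (s \<circ> t)"] t(2) \<tau> by simp
    qed
  qed
qed

theorem corollary3p16:
  fixes \<Gamma> :: "'a::linorder hahn set"
    and d :: "'a \<Rightarrow> 'a series"
  assumes subgroup: "hahn_subgroup \<Gamma>"
    and fund_in: "range fund \<subseteq> \<Gamma>"
    and d_in: "\<And>\<phi>. d \<phi> \<in> gen_series \<Gamma> - {\<lambda>_. 0}"
    and E1: "well_ordered {\<phi>. \<exists>\<psi>>\<phi>. \<not> left_shift (I_iso d \<psi> \<phi>)}"
    and E2: "anti_well_ordered {\<psi>. \<exists>\<phi><\<psi>. \<exists>\<tau>\<^sub>\<phi>\<in>Supp (log_deriv d \<phi>).
               \<exists>\<tau>\<^sub>\<psi>\<in>Supp (log_deriv d \<psi>). LF (\<tau>\<^sub>\<phi> - \<tau>\<^sub>\<psi>) \<ge> fund \<psi>}"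
  shows "extends_to_series_derivation \<Gamma> d"
proof -
  have awo: "anti_well_ordered (Supp (log_deriv d \<phi>))" for \<phi>
    using anti_well_ordered_Supp_log_deriv d_in by blast
  have "SD1 \<Gamma> d"
    unfolding SD1_def using summable_log_derivs[OF awo E1 anti_well_ordered_supp] by blast
  moreover have "SD2 \<Gamma> d"
    unfolding SD2_def gen_series_def using summable_deriv_monomials[OF awo E1 E2] by blast
  ultimately show ?thesis by (simp add: extends_to_series_derivation_def)
qed

end
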